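(* Let $A$ be an indecomposable Cartan matrix of finite type. Then the set of arithmetic $\mathbf{Y}$-frieze patterns associated to $A$ is finite.
   Context: A Cartan matrix $A=(a_{i,j})$ ($r\times r$) is a symmetrisable integer matrix with $a_{i,i}=2$, $a_{i,j}\le0$ for $i\ne j$, $a_{i,j}=0$ iff $a_{j,i}=0$; finite type means all principal minors are positive; indecomposable means there is no nonempty proper $I\subset[1,r]$ with $a_{i,j}=0$ for all $i\in I,j\notin I$. An arithmetic $\mathbf{Y}$-frieze pattern associated to $A$ is a map $k:[1,r]\times\mathbb{Z}\to\mathbb{Z}_{>0}$ such that for all $(i,m)$, \[ k(i,m)k(i,m+1)=\prod_{j=i+1}^r(1+k(j,m))^{-a_{j,i}}\prod_{j=1}^{i-1}(1+k(j,m+1))^{-a_{j,i}}. \] *)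

theory Defs
  imports
    "HOL-Library.FuncSet"
    "Jordan_Normal_Form.Determinant"
    "Jordan_Normal_Form.DL_Submatrix"
begin

text \<open>
  Indices are shifted by one throughout: the paper's index set \<open>[1,r]\<close> is \<open>{..<r}\<close>,
  with the same order (the order matters in the frieze relation).
\<close>

definition symmetrisable_mat :: "nat \<Rightarrow> int mat \<Rightarrow> bool" where
  "symmetrisable_mat r A \<longleftrightarrow>
     (\<exists>D \<in> carrier_mat r r. diagonal_mat D \<and> (\<forall>i<r. 0 < D $$ (i, i)) \<and>
        transpose_mat (D * A) = D * A)"

definition cartan_matrix :: "nat \<Rightarrow> int mat \<Rightarrow> bool" where
  "cartan_matrix r A \<longleftrightarrow>
     A \<in> carrier_mat r r \<and>
     symmetrisable_mat r A \<and>
     (\<forall>i<r. A $$ (i, i) = 2) \<and>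
     (\<forall>i<r. \<forall>j<r. i \<noteq> j \<longrightarrow> A $$ (i, j) \<le> 0) \<and>
     (\<forall>i<r. \<forall>j<r. A $$ (i, j) = 0 \<longleftrightarrow> A $$ (j, i) = 0)"

definition finite_type :: "nat \<Rightarrow> int mat \<Rightarrow> bool" where
  "finite_type r A \<longleftrightarrow> (\<forall>I. I \<subseteq> {..<r} \<and> I \<noteq> {} \<longrightarrow> 0 < det (submatrix A I I))"

definition indecomposable :: "nat \<Rightarrow> int mat \<Rightarrow> bool" where
  "indecomposable r A \<longleftrightarrow>
     \<not> (\<exists>I. I \<noteq> {} \<and> I \<subset> {..<r} \<and> (\<forall>i\<in>I. \<forall>j\<in>{..<r} - I. A $$ (i, j) = 0))"

text \<open>
  A map \<open>[1,r] \<times> \<int> \<rightarrow> \<int>\<^sub>>\<^sub>0\<close> is an element of the extensional function space, so that two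
  patterns are equal iff they agree on the index set. The exponents only involve off-diagonal
  entries of a Cartan matrix, hence \<open>- A $$ (j, i) \<ge> 0\<close> and \<open>nat\<close> does not truncate.
\<close>

definition arithmetic_Y_frieze_patterns :: "nat \<Rightarrow> int mat \<Rightarrow> (nat \<times> int \<Rightarrow> int) set" where
  "arithmetic_Y_frieze_patterns r A =
     {k \<in> ({..<r} \<times> UNIV) \<rightarrow>\<^sub>E {0<..}.
        \<forall>i<r. \<forall>m.
          k (i, m) * k (i, m + 1) =
            (\<Prod>j\<in>{i<..<r}. (1 + k (j, m)) ^ nat (- A $$ (j, i))) *
            (\<Prod>j\<in>{..<i}. (1 + k (j, m + 1)) ^ nat (- A $$ (j, i)))}"

end

theory Submission
  imports Defs Complex_Main
begin

text \<open>
  Let \<open>d\<close> be a symmetriser and \<open>y i m = ln (k (i, m)) / d i\<close>.  Since \<open>ln (1 + k) - ln k\<close> is bounded,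
  \<open>y\<close> satisfies, up to a universally bounded error, the linear recurrence given by the action of a
  Coxeter element, which preserves the form \<open>d i * a i j\<close>.  Finite type makes this form positive
  definite, so \<open>y\<close> grows at most linearly with a universal slope.  Since the Coxeter element does not
  have eigenvalue 1, summing the recurrence bounds the long-time averages of \<open>y \<ge> 0\<close>, so every
  pattern has, after a shift, a column in a fixed finite set.  As a column determines the pattern,
  the pigeonhole principle makes every pattern periodic, and there are finitely many of them.
  No use is made of the Zamolodchikov periodicity theorem.
\<close>

section \<open>Coercivity of positive definite quadratic forms\<close>

definition qform :: "nat \<Rightarrow> (nat \<Rightarrow> nat \<Rightarrow> real) \<Rightarrow> (nat \<Rightarrow> real) \<Rightarrow> real" where
  "qform n b x = (\<Sum>i<n. \<Sum>j<n. b i j * x i * x j)"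

lemma qform_alt: "qform n b x = (\<Sum>i<n. x i * (\<Sum>j<n. b i j * x j))"
  unfolding qform_def by (simp add: sum_distrib_left mult_ac)

lemma qform_add:
  assumes sym: "\<And>i j. i < n \<Longrightarrow> j < n \<Longrightarrow> b i j = b j i"
  shows "qform n b (\<lambda>i. x i + t * z i) =
    qform n b x + 2 * t * (\<Sum>i<n. x i * (\<Sum>j<n. b i j * z j)) + t\<^sup>2 * qform n b z"
proof -
  have sw: "(\<Sum>i<n. \<Sum>j<n. b i j * z i * x j) = (\<Sum>i<n. \<Sum>j<n. b i j * x i * z j)"
    by (subst sum.swap) (intro sum.cong refl, use sym in simp)
  have "qform n b (\<lambda>i. x i + t * z i) =
    (\<Sum>i<n. \<Sum>j<n. b i j * x i * x j) + t * (\<Sum>i<n. \<Sum>j<n. b i j * x i * z j)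
     + t * (\<Sum>i<n. \<Sum>j<n. b i j * z i * x j) + t\<^sup>2 * (\<Sum>i<n. \<Sum>j<n. b i j * z i * z j)"
    unfolding qform_def sum_distrib_left sum.distrib[symmetric]
    by (intro sum.cong refl) (simp add: algebra_simps power2_eq_square)
  also have "\<dots> = qform n b x + 2 * t * (\<Sum>i<n. \<Sum>j<n. b i j * x i * z j) + t\<^sup>2 * qform n b z"
    unfolding sw qform_def by simp
  finally show ?thesis by (simp add: sum_distrib_left mult_ac)
qed

text \<open>Completing the square, one coordinate at a time: after splitting off a vector orthogonal
  to the first \<open>n\<close> coordinates, the form in \<open>n + 1\<close> variables is the form
  in \<open>n\<close> variables plus a positive multiple of a square. A constant \<mu> is carried
  along instead of mere positivity because the later estimates divide by it.\<close>

lemma sylvester_criterion: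
  fixes b :: "nat \<Rightarrow> nat \<Rightarrow> real"
  assumes sym: "\<And>i j. i < n \<Longrightarrow> j < n \<Longrightarrow> b i j = b j i"
    and minors: "\<And>k. 0 < k \<Longrightarrow> k \<le> n \<Longrightarrow> 0 < det (mat k k (\<lambda>(i, j). b i j))"
  shows "\<exists>\<mu>>0. \<forall>x. \<mu> * (\<Sum>i<n. (x i)\<^sup>2) \<le> qform n b x"
  using assms
proof (induction n)
  case 0
  show ?case by (intro exI[of _ 1]) (simp add: qform_def)
next
  case (Suc n)
  obtain \<mu> where \<mu>: "0 < \<mu>" "\<And>x. \<mu> * (\<Sum>i<n. (x i)\<^sup>2) \<le> qform n b x"
    using Suc.IH Suc.prems by fastforce
  define B where "B = mat (Suc n) (Suc n) (\<lambda>(i, j). b i j)"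
  \<comment> \<open>The cofactor vector \<open>z\<close> is \<open>b\<close>-orthogonal to the first \<open>n\<close> coordinates.\<close>
  define z where "z i = adj_mat B $$ (i, n)" for i
  have B: "B \<in> carrier_mat (Suc n) (Suc n)" by (simp add: B_def)
  have detB: "0 < det B" using Suc.prems(2)[of "Suc n"] by (simp add: B_def)
  have Bz: "(\<Sum>j<Suc n. b i j * z j) = (if i = n then det B else 0)" if "i < Suc n" for i
  proof -
    have "(B * adj_mat B) $$ (i, n) = (\<Sum>j<Suc n. b i j * z j)"
      using that B adj_mat(1)[OF B]
      by (auto simp: scalar_prod_def z_def B_def atLeast0LessThan intro!: sum.cong)
    moreover have "(B * adj_mat B) $$ (i, n) = (if i = n then det B else 0)"
      using that by (simp add: adj_mat(2)[OF B])
    ultimately show ?thesis by metis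
  qed
  have "mat_delete B n n = mat n n (\<lambda>(i, j). b i j)"
    by (rule eq_matI) (auto simp: mat_delete_def B_def)
  hence "z n = det (mat n n (\<lambda>(i, j). b i j))"
    using B by (simp add: z_def adj_mat_def cofactor_def)
  \<comment> \<open>For \<open>n = 0\<close> the hypothesis on minors is silent, but the empty
    determinant is 1.\<close>
  hence zn: "0 < z n" using Suc.prems(2)[of n] by (cases "n = 0") auto
  have Qz: "qform (Suc n) b z = z n * det B"
    by (simp add: qform_alt Bz del: sum.lessThan_Suc) simp
  define Z where "Z = (\<Sum>i<Suc n. (z i)\<^sup>2)"
  have Z: "0 < Z" using zn by (auto simp: Z_def intro!: add_nonneg_pos sum_nonneg)
  \<comment> \<open>The halves absorb the factor 2 lost in
    \<open>(u + t z)^2 \<le> 2 u^2 + 2 t^2 z^2\<close>; the two arguments of \<open>min\<close>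
    serve the part in the first \<open>n\<close> coordinates and the part along
    \<open>z\<close>.\<close>
  define \<mu>' where "\<mu>' = min (\<mu> / 2) (z n * det B / (2 * Z))"
  have \<mu>': "0 < \<mu>'" using \<mu> zn detB Z by (simp add: \<mu>'_def)
  have \<mu>'1: "2 * \<mu>' \<le> \<mu>" by (simp add: \<mu>'_def min_def)
  have "\<mu>' \<le> z n * det B / (2 * Z)" by (simp add: \<mu>'_def)
  hence \<mu>'2: "2 * \<mu>' * Z \<le> z n * det B" using Z by (simp add: field_simps)
  have "\<mu>' * (\<Sum>i<Suc n. (x i)\<^sup>2) \<le> qform (Suc n) b x" for x
  proof -
    \<comment> \<open>This \<open>t\<close> clears the last coordinate of \<open>x - t z\<close>,
      the only one that \<open>b z\<close> sees, so the mixed term of the form vanishes.\<close>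
    define t where "t = x n / z n"
    define u where "u i = x i - t * z i" for i
    have un: "u n = 0" using zn by (simp add: u_def t_def)
    have "qform (Suc n) b x = qform (Suc n) b (\<lambda>i. u i + t * z i)" by (simp add: u_def)
    also have "\<dots> = qform (Suc n) b u
        + 2 * t * (\<Sum>i<Suc n. u i * (\<Sum>j<Suc n. b i j * z j)) + t\<^sup>2 * (z n * det B)"
      using qform_add[of "Suc n" b u t z] Suc.prems(1) unfolding Qz by simp
    also have "(\<Sum>i<Suc n. u i * (\<Sum>j<Suc n. b i j * z j)) = 0"
      by (rule sum.neutral) (auto simp: Bz un simp del: sum.lessThan_Suc)
    also have "qform (Suc n) b u = qform n b u" by (simp add: qform_def un)
    finally have Q: "qform (Suc n) b x = qform n b u + t\<^sup>2 * (z n * det B)" by simp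
    have "(\<Sum>i<Suc n. (x i)\<^sup>2) \<le> (\<Sum>i<Suc n. 2 * (u i)\<^sup>2 + 2 * t\<^sup>2 * (z i)\<^sup>2)"
    proof (rule sum_mono)
      fix i
      have "0 \<le> (u i - t * z i)\<^sup>2" by simp
      thus "(x i)\<^sup>2 \<le> 2 * (u i)\<^sup>2 + 2 * t\<^sup>2 * (z i)\<^sup>2"
        by (simp add: u_def power2_eq_square algebra_simps)
    qed
    also have "\<dots> = 2 * (\<Sum>i<n. (u i)\<^sup>2) + 2 * t\<^sup>2 * Z"
      by (simp add: sum.distrib sum_distrib_left Z_def un algebra_simps)
    finally have "\<mu>' * (\<Sum>i<Suc n. (x i)\<^sup>2) \<le> \<mu>' * (2 * (\<Sum>i<n. (u i)\<^sup>2) + 2 * t\<^sup>2 * Z)"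
      using \<mu>' by simp
    also have "\<dots> = (2 * \<mu>') * (\<Sum>i<n. (u i)\<^sup>2) + t\<^sup>2 * (2 * \<mu>' * Z)" by (simp add: algebra_simps)
    also have "\<dots> \<le> \<mu> * (\<Sum>i<n. (u i)\<^sup>2) + t\<^sup>2 * (z n * det B)"
      using \<mu>'1 \<mu>'2 by (intro add_mono mult_right_mono mult_left_mono sum_nonneg) auto
    also have "\<dots> \<le> qform (Suc n) b x" using \<mu>(2)[of u] Q by simp
    finally show ?thesis .
  qed
  with \<mu>' show ?case by blast
qed

section \<open>Bounded perturbations of the Coxeter recurrence\<close>

text \<open>With \<open>\<Delta> = y' - y\<close>, the difference is \<open>b \<Delta> (y' + y)\<close>; substituting the recurrence leaves,
  besides the errors \<open>e\<close>, an antisymmetric double sum, which vanishes.\<close>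

lemma qform_step:
  fixes b :: "nat \<Rightarrow> nat \<Rightarrow> real"
  assumes sym: "\<And>i j. i < n \<Longrightarrow> j < n \<Longrightarrow> b i j = b j i"
    and e: "\<And>i. i < n \<Longrightarrow>
      e i = b i i / 2 * (y i + y' i) + (\<Sum>j\<in>{i<..<n}. b i j * y j) + (\<Sum>j<i. b i j * y' j)"
  shows "qform n b y' - qform n b y = 2 * (\<Sum>i<n. e i * (y' i - y i))"
proof -
  define \<Delta> where "\<Delta> i = y' i - y i" for i
  \<comment> \<open>Row \<open>i\<close> of the recurrence takes the old values for
    \<open>j > i\<close> and the new ones for \<open>j < i\<close>. The mean of old and new exceeds
    the value taken by half of \<open>s i j * \<Delta> j\<close>.\<close>
  define s :: "nat \<Rightarrow> nat \<Rightarrow> real" where "s i j = (if i < j then 1 else if j < i then -1 else 0)" for i j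
  have split: "(\<Sum>j<n. f j) = (\<Sum>j<i. f j) + f i + (\<Sum>j\<in>{i<..<n}. f j)"
    if "i < n" for i and f :: "nat \<Rightarrow> real"
  proof -
    have I: "{..<n} = insert i ({..<i} \<union> {i<..<n})" using that by auto
    have "sum f ({..<i} \<union> {i<..<n}) = sum f {..<i} + sum f {i<..<n}"
      by (rule sum.union_disjoint) auto
    thus ?thesis unfolding I by simp
  qed
  have row: "(\<Sum>j<n. b i j * (y' j + y j)) = 2 * e i + (\<Sum>j<n. b i j * s i j * \<Delta> j)" if i: "i < n" for i
    unfolding split[OF i] e[OF i]
    by (simp add: s_def \<Delta>_def sum.distrib sum_subtractf sum_negf ring_distribs)
  have anti: "(\<Sum>i<n. \<Sum>j<n. b i j * s i j * \<Delta> i * \<Delta> j) = 0" (is "?T = 0")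
  proof -
    have "?T = (\<Sum>j<n. \<Sum>i<n. b i j * s i j * \<Delta> i * \<Delta> j)" by (rule sum.swap)
    also have "\<dots> = (\<Sum>j<n. \<Sum>i<n. - (b j i * s j i * \<Delta> j * \<Delta> i))"
      by (intro sum.cong refl) (use sym in \<open>auto simp: s_def\<close>)
    also have "\<dots> = - ?T" by (simp add: sum_negf)
    finally show ?thesis by simp
  qed
  have "qform n b y' = qform n b (\<lambda>i. y i + 1 * \<Delta> i)" by (simp add: \<Delta>_def)
  also have "\<dots> = qform n b y + 2 * (\<Sum>i<n. y i * (\<Sum>j<n. b i j * \<Delta> j)) + qform n b \<Delta>"
    using qform_add[of n b y 1 \<Delta>] sym by simp
  also have "(\<Sum>i<n. y i * (\<Sum>j<n. b i j * \<Delta> j)) = (\<Sum>i<n. \<Delta> i * (\<Sum>j<n. b i j * y j))"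
    unfolding sum_distrib_left by (subst sum.swap) (intro sum.cong refl, use sym in simp)
  finally have "qform n b y' - qform n b y = (\<Sum>i<n. \<Delta> i * (\<Sum>j<n. b i j * (2 * y j + \<Delta> j)))"
    by (simp add: qform_alt sum.distrib sum_distrib_left algebra_simps)
  also have "\<dots> = (\<Sum>i<n. \<Delta> i * (\<Sum>j<n. b i j * (y' j + y j)))" by (simp add: \<Delta>_def add.commute)
  also have "\<dots> = (\<Sum>i<n. \<Delta> i * (2 * e i + (\<Sum>j<n. b i j * s i j * \<Delta> j)))"
    by (simp add: row)
  also have "\<dots> = 2 * (\<Sum>i<n. e i * \<Delta> i) + (\<Sum>i<n. \<Sum>j<n. b i j * s i j * \<Delta> i * \<Delta> j)"
    by (simp add: sum.distrib sum_distrib_left algebra_simps)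
  finally show ?thesis unfolding anti by (simp add: \<Delta>_def)
qed

text \<open>Lets the square root of the form serve as a norm in the estimates for the
  recurrence.\<close>

lemma coercive_coordinate_bound:
  assumes "0 < \<mu>" and "\<mu> * (\<Sum>i<n. (x i)\<^sup>2) \<le> qform n b x" and "i < n"
  shows "\<bar>x i\<bar> \<le> sqrt (qform n b x) / sqrt \<mu>"
proof -
  have "(x i)\<^sup>2 \<le> (\<Sum>i<n. (x i)\<^sup>2)" using assms(3) by (intro member_le_sum) auto
  hence "\<mu> * (x i)\<^sup>2 \<le> qform n b x" using assms by (meson mult_left_mono less_imp_le order_trans)
  hence "(x i)\<^sup>2 \<le> qform n b x / \<mu>" using assms(1) by (simp add: field_simps)
  hence "sqrt ((x i)\<^sup>2) \<le> sqrt (qform n b x / \<mu>)" by (rule real_sqrt_le_mono)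
  thus ?thesis by (simp add: real_sqrt_divide)
qed

text \<open>Note that \<open>R\<close> does not depend on \<open>y\<close>, although the time at which the bound holds does.\<close>

lemma recurrence_visits_bounded_set:
  fixes b :: "nat \<Rightarrow> nat \<Rightarrow> real"
  assumes sym: "\<And>i j. i < n \<Longrightarrow> j < n \<Longrightarrow> b i j = b j i"
    and \<mu>: "0 < \<mu>" "\<And>x. \<mu> * (\<Sum>i<n. (x i)\<^sup>2) \<le> qform n b x"
    and C: "0 \<le> C"
  shows "\<exists>R. \<forall>y. (\<forall>i<n. \<forall>m. 0 \<le> y i m) \<longrightarrow>
    (\<forall>i<n. \<forall>m. \<bar>b i i / 2 * (y i m + y i (Suc m)) + (\<Sum>j\<in>{i<..<n}. b i j * y j m)
       + (\<Sum>j<i. b i j * y j (Suc m))\<bar> \<le> C) \<longrightarrow>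
    (\<exists>m. \<forall>i<n. y i m \<le> R)"
proof -
  define \<kappa> where "\<kappa> = 1 / sqrt \<mu>"
  have \<kappa>: "0 < \<kappa>" using \<mu> by (simp add: \<kappa>_def)
  have coord: "\<bar>x i\<bar> \<le> \<kappa> * sqrt (qform n b x)" if "i < n" for x i
    using coercive_coordinate_bound[OF \<mu>(1) \<mu>(2) that, of x] by (simp add: \<kappa>_def)
  have Q0: "0 \<le> qform n b x" for x
    using \<mu>(1) by (intro order_trans[OF _ \<mu>(2)[of x]] mult_nonneg_nonneg sum_nonneg) auto
  define \<beta> where "\<beta> = (\<Sum>i<n. \<Sum>j<n. \<bar>b i j\<bar>)"
  have \<beta>row: "(\<Sum>j<n. \<bar>b i j\<bar>) \<le> \<beta>" if "i < n" for i
    unfolding \<beta>_def using that by (intro member_le_sum[of i _ "\<lambda>i. \<Sum>j<n. \<bar>b i j\<bar>"] sum_nonneg) auto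
  have \<beta>: "0 \<le> \<beta>" unfolding \<beta>_def by (intro sum_nonneg) auto
  \<comment> \<open>\<open>K\<close> bounds the growth of the norm of \<open>y\<close> per time
    step. \<open>K1\<close> and \<open>K2\<close> are the coefficients of the time and of the
    initial norm in the estimate of the partial sums. All three are fixed before \<open>y\<close>,
    which makes the final bound uniform.\<close>
  define K where "K = 2 * C * n * \<kappa>"
  define K1 where "K1 = \<kappa> * n * \<kappa> * (C + 2 * \<beta> * \<kappa> * K)"
  define K2 where "K2 = \<kappa> * n * \<kappa> * 4 * \<beta> * \<kappa>"
  have main: "\<exists>m. \<forall>i<n. y i m \<le> n * K1 + 1"
    if y0: "\<And>i m. i < n \<Longrightarrow> 0 \<le> y i m"
      and rec: "\<And>i m. i < n \<Longrightarrow> \<bar>b i i / 2 * (y i m + y i (Suc m)) + (\<Sum>j\<in>{i<..<n}. b i j * y j m)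
       + (\<Sum>j<i. b i j * y j (Suc m))\<bar> \<le> C" for y
  proof -
    define e where "e m i = b i i / 2 * (y i m + y i (Suc m)) + (\<Sum>j\<in>{i<..<n}. b i j * y j m)
       + (\<Sum>j<i. b i j * y j (Suc m))" for m i
    have eC: "\<bar>e m i\<bar> \<le> C" if "i < n" for m i using rec[OF that] by (simp add: e_def)
    define q where "q m = sqrt (qform n b (\<lambda>i. y i m))" for m
    have q0: "0 \<le> q m" for m using Q0 by (simp add: q_def)
    have q2: "(q m)\<^sup>2 = qform n b (\<lambda>i. y i m)" for m using Q0 by (simp add: q_def)
    have yq: "\<bar>y i m\<bar> \<le> \<kappa> * q m" if "i < n" for i m using coord[OF that] by (simp add: q_def)
    have q_step: "q (Suc m) \<le> q m + K" for m
    \<comment> \<open>The other case divides by this sum; if it vanishes, both nonnegative norms are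
      0.\<close>
    proof (cases "q (Suc m) + q m = 0")
      case True
      moreover have "0 \<le> K" using C \<kappa> by (simp add: K_def)
      ultimately show ?thesis using q0[of m] q0[of "Suc m"] by linarith
    next
      case False
      \<comment> \<open>The form may grow by an amount proportional to the norm, but a difference of
        squares factors, so the norm itself grows by at most a constant.\<close>
      have "(q (Suc m))\<^sup>2 - (q m)\<^sup>2 = 2 * (\<Sum>i<n. e m i * (y i (Suc m) - y i m))"
        unfolding q2 by (rule qform_step) (use sym in \<open>auto simp: e_def\<close>)
      also have "\<dots> \<le> 2 * (\<Sum>i<n. C * (\<kappa> * (q (Suc m) + q m)))"
      proof (intro mult_left_mono sum_mono)
        fix i assume "i \<in> {..<n}"
        hence i: "i < n" by simp
        have "e m i * (y i (Suc m) - y i m) \<le> \<bar>e m i\<bar> * \<bar>y i (Suc m) - y i m\<bar>"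
          by (metis abs_ge_self abs_mult)
        also have "\<dots> \<le> C * (\<kappa> * (q (Suc m) + q m))"
          using eC[OF i, of m] yq[OF i, of m] yq[OF i, of "Suc m"] C
          by (intro mult_mono) (auto simp: ring_distribs)
        finally show "e m i * (y i (Suc m) - y i m) \<le> C * (\<kappa> * (q (Suc m) + q m))" .
      qed simp
      also have "\<dots> = K * (q (Suc m) + q m)" by (simp add: K_def)
      finally have "(q (Suc m) - q m) * (q (Suc m) + q m) \<le> K * (q (Suc m) + q m)"
        by (simp add: power2_eq_square algebra_simps)
      moreover have "0 < q (Suc m) + q m" using False q0[of m] q0[of "Suc m"] by linarith
      ultimately show ?thesis by (simp add: mult_le_cancel_right)
    qed
    have q_lin: "q M \<le> q 0 + K * real M" for M
    proof (induction M)
      case (Suc M)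
      thus ?case using q_step[of M] by (simp add: ring_distribs)
    qed simp
    \<comment> \<open>Summing over time turns the recurrence into a linear system for the partial
      sums \<open>S\<close>, up to the errors and the boundary terms \<Delta>. Both grow at most
      linearly in \<open>M\<close>, the latter because \<open>q\<close> does.\<close>
    have avg: "(\<Sum>m<M. y i m) \<le> K1 * real M + K2 * q 0" if i: "i < n" for i M
    proof -
      define S where "S i = (\<Sum>m<M. y i m)" for i
      define \<Delta> where "\<Delta> i = y i M - y i 0" for i
      define \<sigma> where "\<sigma> = sqrt (qform n b S)"
      define P where "P = C * real M + 2 * \<beta> * \<kappa> * (q M + q 0)"
      have P: "0 \<le> P" using C \<beta> \<kappa> q0[of M] q0[of 0] by (simp add: P_def)
      have \<sigma>0: "0 \<le> \<sigma>" and \<sigma>2: "\<sigma> * \<sigma> = qform n b S" using Q0[of S] by (auto simp: \<sigma>_def)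
      have shift: "(\<Sum>m<M. y i (Suc m)) = S i + \<Delta> i" for i
        unfolding S_def \<Delta>_def using sum.lessThan_Suc_shift[of "y i" M] by simp
      have \<Delta>: "\<bar>\<Delta> i\<bar> \<le> \<kappa> * (q M + q 0)" if "i < n" for i
        using yq[OF that, of M] yq[OF that, of 0] by (simp add: \<Delta>_def ring_distribs)
      have row: "\<bar>\<Sum>j<n. b i j * S j\<bar> \<le> P" if i: "i < n" for i
      proof -
        have I: "{..<n} = insert i ({..<i} \<union> {i<..<n})" using i by auto
        have "(\<Sum>j\<in>{..<i} \<union> {i<..<n}. b i j * S j)
            = (\<Sum>j<i. b i j * S j) + (\<Sum>j\<in>{i<..<n}. b i j * S j)"
          by (rule sum.union_disjoint) auto
        hence sumI: "(\<Sum>j<n. b i j * S j) =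
            b i i * S i + ((\<Sum>j<i. b i j * S j) + (\<Sum>j\<in>{i<..<n}. b i j * S j))"
          unfolding I by simp
        have dist: "(\<Sum>j<i. b i j * (S j + \<Delta> j)) = (\<Sum>j<i. b i j * S j) + (\<Sum>j<i. b i j * \<Delta> j)"
          by (simp add: ring_distribs sum.distrib)
        have "(\<Sum>m<M. e m i) = b i i / 2 * (S i + (S i + \<Delta> i)) + (\<Sum>j\<in>{i<..<n}. b i j * S j)
            + (\<Sum>j<i. b i j * (S j + \<Delta> j))"
        proof -
          have "(\<Sum>m<M. \<Sum>j\<in>{i<..<n}. b i j * y j m) = (\<Sum>j\<in>{i<..<n}. b i j * S j)"
            by (subst sum.swap) (simp add: S_def sum_distrib_left)
          moreover have "(\<Sum>m<M. \<Sum>j<i. b i j * y j (Suc m)) = (\<Sum>j<i. b i j * (S j + \<Delta> j))"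
            by (subst sum.swap) (simp add: shift[symmetric] sum_distrib_left)
          moreover have "(\<Sum>m<M. b i i / 2 * (y i m + y i (Suc m))) = b i i / 2 * (S i + (S i + \<Delta> i))"
            unfolding sum_distrib_left[symmetric] sum.distrib shift by (simp add: S_def)
          ultimately show ?thesis by (simp add: e_def sum.distrib)
        qed
        \<comment> \<open>The terms with old and with new values have merged into a full row of
          \<open>b\<close>. Coercivity makes \<open>b\<close> invertible, so \<open>S\<close> can be
          recovered; this is where the absence of the eigenvalue 1 enters.\<close>
        hence eq: "(\<Sum>j<n. b i j * S j) = (\<Sum>m<M. e m i) - b i i / 2 * \<Delta> i - (\<Sum>j<i. b i j * \<Delta> j)"
          unfolding sumI dist by (simp add: ring_distribs)
        have "\<bar>\<Sum>m<M. e m i\<bar> \<le> (\<Sum>m<M. C)"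
          using eC[OF i] by (intro order_trans[OF sum_abs] sum_mono)
        hence 1: "\<bar>\<Sum>m<M. e m i\<bar> \<le> C * real M" by (simp add: mult.commute)
        have "\<bar>b i i / 2\<bar> \<le> \<bar>b i i\<bar>" by simp
        also have "\<dots> \<le> (\<Sum>j<n. \<bar>b i j\<bar>)"
          using i by (intro member_le_sum[of i _ "\<lambda>j. \<bar>b i j\<bar>"]) auto
        also have "\<dots> \<le> \<beta>" by (rule \<beta>row[OF i])
        finally have "\<bar>b i i / 2\<bar> \<le> \<beta>" .
        hence 2: "\<bar>b i i / 2 * \<Delta> i\<bar> \<le> \<beta> * (\<kappa> * (q M + q 0))"
          unfolding abs_mult[of "b i i / 2"] using \<beta> \<Delta>[OF i] by (intro mult_mono) auto
        have "\<bar>\<Sum>j<i. b i j * \<Delta> j\<bar> \<le> (\<Sum>j<i. \<bar>b i j\<bar> * (\<kappa> * (q M + q 0)))"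
          using i \<Delta> by (intro order_trans[OF sum_abs] sum_mono) (auto simp: abs_mult intro!: mult_left_mono)
        also have "\<dots> = (\<Sum>j<i. \<bar>b i j\<bar>) * (\<kappa> * (q M + q 0))" by (simp add: sum_distrib_right)
        also have "\<dots> \<le> \<beta> * (\<kappa> * (q M + q 0))"
        proof (rule mult_right_mono)
          have "(\<Sum>j<i. \<bar>b i j\<bar>) \<le> (\<Sum>j<n. \<bar>b i j\<bar>)" using i by (intro sum_mono2) auto
          thus "(\<Sum>j<i. \<bar>b i j\<bar>) \<le> \<beta>" using \<beta>row[OF i] by simp
          show "0 \<le> \<kappa> * (q M + q 0)" using \<kappa> q0[of M] q0[of 0] by simp
        qed
        finally show ?thesis using 1 2 unfolding eq P_def by (simp add: algebra_simps)
      qed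
      \<comment> \<open>Pairing \<open>b S\<close> with \<open>S\<close> bounds the form by a
        multiple of \<open>\<sigma> * P\<close>; one factor \<sigma> then cancels, which leaves a
        bound linear in \<open>P\<close>.\<close>
      have "\<sigma> * \<sigma> \<le> (\<Sum>i<n. (\<kappa> * \<sigma>) * P)"
        unfolding \<sigma>2 qform_alt
      proof (intro sum_mono)
        fix i assume "i \<in> {..<n}"
        hence i: "i < n" by simp
        have "S i * (\<Sum>j<n. b i j * S j) \<le> \<bar>S i\<bar> * \<bar>\<Sum>j<n. b i j * S j\<bar>"
          by (metis abs_ge_self abs_mult)
        also have "\<dots> \<le> (\<kappa> * \<sigma>) * P"
          using coord[OF i, of S] row[OF i] \<kappa> \<sigma>0 by (intro mult_mono) (auto simp: \<sigma>_def)
        finally show "S i * (\<Sum>j<n. b i j * S j) \<le> \<kappa> * \<sigma> * P" .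
      qed
      hence "\<sigma> * \<sigma> \<le> (n * \<kappa> * P) * \<sigma>" by (simp add: mult_ac)
      hence \<sigma>P: "\<sigma> \<le> n * \<kappa> * P"
        using \<sigma>0 P \<kappa> by (cases "\<sigma> = 0") (auto simp: mult_le_cancel_right)
      have "P \<le> C * real M + 2 * \<beta> * \<kappa> * (q 0 + K * real M + q 0)"
        unfolding P_def using q_lin[of M] \<beta> \<kappa> by (intro add_left_mono mult_left_mono) auto
      also have "\<dots> = (C + 2 * \<beta> * \<kappa> * K) * real M + 4 * \<beta> * \<kappa> * q 0" by (simp add: algebra_simps)
      finally have P': "P \<le> (C + 2 * \<beta> * \<kappa> * K) * real M + 4 * \<beta> * \<kappa> * q 0" .
      have "S i \<le> \<kappa> * \<sigma>" using coord[OF i, of S] by (simp add: \<sigma>_def)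
      also have "\<dots> \<le> \<kappa> * (n * \<kappa> * P)" using \<sigma>P \<kappa> by simp
      also have "\<dots> \<le> \<kappa> * (n * \<kappa> * ((C + 2 * \<beta> * \<kappa> * K) * real M + 4 * \<beta> * \<kappa> * q 0))"
        using P' \<kappa> by (intro mult_left_mono) auto
      also have "\<dots> = K1 * real M + K2 * q 0" by (simp add: K1_def K2_def algebra_simps)
      finally show ?thesis by (simp add: S_def)
    qed
    show ?thesis
    \<comment> \<open>If some coordinate were too large at every time, nonnegativity would keep the
      sum of all coordinates at or above \<open>n * K1 + 1\<close>. The estimate \<open>avg\<close>
      allows only the slope \<open>n * K1\<close>, so the surplus of 1 per time step eventually
      beats the constant \<open>n * K2 * q 0\<close>.\<close>
    proof (rule ccontr)
      assume no: "\<not> ?thesis"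
      have big: "n * K1 + 1 \<le> (\<Sum>i<n. y i m)" for m
      proof -
        obtain i where i: "i < n" "n * K1 + 1 < y i m" using no by (meson not_le)
        moreover have "y i m \<le> (\<Sum>i<n. y i m)"
          using i y0 by (intro member_le_sum[of i _ "\<lambda>i. y i m"]) auto
        ultimately show ?thesis by linarith
      qed
      obtain M where M: "n * K2 * q 0 < real M" using reals_Archimedean2 by blast
      have "real M * (n * K1 + 1) = (\<Sum>m<M. n * K1 + 1)" by simp
      also have "\<dots> \<le> (\<Sum>m<M. \<Sum>i<n. y i m)" by (intro sum_mono big)
      also have "\<dots> = (\<Sum>i<n. \<Sum>m<M. y i m)" by (rule sum.swap)
      also have "\<dots> \<le> (\<Sum>i<n. K1 * real M + K2 * q 0)" by (intro sum_mono avg) simp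
      also have "\<dots> = real M * (n * K1) + n * K2 * q 0" by (simp add: algebra_simps)
      finally show False using M by (simp add: algebra_simps)
    qed
  qed
  show ?thesis
    by (intro exI[of _ "n * K1 + 1"] allI impI, rule main) (elim allE impE, assumption+)+
qed

section \<open>Orbits of an injective map\<close>

text \<open>By pigeonhole every orbit is periodic, hence it is the orbit of a point of \<open>V\<close>.\<close>

lemma finite_if_orbits_visit_finite_set:
  assumes inj: "inj T" and closed: "\<And>x. x \<in> X \<Longrightarrow> T x \<in> X"
    and V: "finite V" "V \<subseteq> X"
    and visit: "\<And>x. x \<in> X \<Longrightarrow> \<exists>m. (T ^^ m) x \<in> V"
  shows "finite X"
proof -
  have closed': "(T ^^ m) x \<in> X" if "x \<in> X" for m x by (induction m) (use that closed in auto)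
  have per: "\<exists>p>0. (T ^^ p) x = x" if x: "x \<in> X" for x
  proof -
    define N where "N = {m. (T ^^ m) x \<in> V}"
    \<comment> \<open>The orbit stays in \<open>X\<close>, so from every time \<open>m\<close>
      onwards it visits \<open>V\<close> again.\<close>
    have "infinite N"
      unfolding infinite_nat_iff_unbounded_le
    proof
      fix m
      obtain l where "(T ^^ l) ((T ^^ m) x) \<in> V" using visit[OF closed'[OF x]] by blast
      hence "l + m \<in> N" by (simp add: N_def funpow_add)
      thus "\<exists>k\<ge>m. k \<in> N" by (intro exI[of _ "l + m"]) simp
    qed
    moreover have "finite ((\<lambda>m. (T ^^ m) x) ` N)"
      by (rule finite_subset[OF _ V(1)]) (auto simp: N_def)
    ultimately have "\<not> inj_on (\<lambda>m. (T ^^ m) x) N" using finite_imageD by blast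
    then obtain c d where "c < d" "(T ^^ c) x = (T ^^ d) x"
      unfolding inj_on_def by (metis nat_neq_iff)
    \<comment> \<open>Injectivity cancels the common \<open>T ^^ c\<close>: the orbit returns to
      \<open>x\<close> itself and is not merely eventually periodic.\<close>
    moreover from this have "(T ^^ c) ((T ^^ (d - c)) x) = (T ^^ c) x"
      by (metis add_diff_inverse_nat comp_apply funpow_add less_imp_not_less)
    hence "(T ^^ (d - c)) x = x" by (rule injD[OF inj_fn[OF inj]])
    ultimately show ?thesis by (intro exI[of _ "d - c"]) simp
  qed
  have mult: "(T ^^ (k * p)) x = x" if "(T ^^ p) x = x" for k p x
    by (induction k) (use that in \<open>simp_all add: funpow_add\<close>)
  have orbit: "finite (range (\<lambda>m. (T ^^ m) x))" if x: "x \<in> X" for x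
  proof -
    obtain p where p: "p > 0" "(T ^^ p) x = x" using per[OF x] by blast
    have "(T ^^ m) x = (T ^^ (m mod p)) x" for m
    proof -
      have "(T ^^ m) x = (T ^^ (m mod p)) ((T ^^ (m div p * p)) x)"
        by (metis comp_apply funpow_add mod_div_mult_eq)
      thus ?thesis by (simp add: mult[OF p(2)])
    qed
    hence "range (\<lambda>m. (T ^^ m) x) \<subseteq> (\<lambda>m. (T ^^ m) x) ` {..<p}" using p(1) by fastforce
    thus ?thesis by (rule finite_subset) simp
  qed
  have "X \<subseteq> (\<Union>v\<in>V. range (\<lambda>m. (T ^^ m) v))"
  proof
    fix x assume x: "x \<in> X"
    obtain p where p: "p > 0" "(T ^^ p) x = x" using per[OF x] by blast
    obtain m where m: "(T ^^ m) x \<in> V" using visit[OF x] by blast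
    \<comment> \<open>This keeps the natural subtraction \<open>m * p - m\<close> from truncating.
      Going on from time \<open>m\<close> to the multiple \<open>m * p\<close> of the period leads
      back to \<open>x\<close>.\<close>
    have "m \<le> m * p" using p(1) by simp
    hence "(T ^^ (m * p - m)) ((T ^^ m) x) = (T ^^ (m * p)) x"
      by (metis comp_apply funpow_add le_add_diff_inverse2)
    hence "x = (T ^^ (m * p - m)) ((T ^^ m) x)" by (simp add: mult[OF p(2)])
    thus "x \<in> (\<Union>v\<in>V. range (\<lambda>m. (T ^^ m) v))" using m by blast
  qed
  thus ?thesis using V orbit by (meson finite_UN_I finite_subset subsetD)
qed

section \<open>Shifting friezes, and their determination by one column\<close>

definition frieze_shift :: "(nat \<times> int \<Rightarrow> int) \<Rightarrow> nat \<times> int \<Rightarrow> int" where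
  "frieze_shift k = (\<lambda>(i, m). k (i, m + 1))"

lemma frieze_shift_funpow: "(frieze_shift ^^ n) k (i, m) = k (i, m + int n)"
  by (induction n arbitrary: m) (auto simp: frieze_shift_def algebra_simps)

lemma inj_frieze_shift: "inj frieze_shift"
proof
  fix k l assume eq: "frieze_shift k = frieze_shift l"
  have "k (i, m) = l (i, m)" for i m
    using fun_cong[OF eq, of "(i, m - 1)"] by (simp add: frieze_shift_def)
  thus "k = l" by auto
qed

lemma frieze_pos:
  "k \<in> arithmetic_Y_frieze_patterns r A \<Longrightarrow> i < r \<Longrightarrow> 0 < k (i, m)"
  by (fastforce simp: arithmetic_Y_frieze_patterns_def)

lemma frieze_rel:
  "k \<in> arithmetic_Y_frieze_patterns r A \<Longrightarrow> i < r \<Longrightarrow> k (i, m) * k (i, m + 1) =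
            (\<Prod>j\<in>{i<..<r}. (1 + k (j, m)) ^ nat (- A $$ (j, i))) *
            (\<Prod>j\<in>{..<i}. (1 + k (j, m + 1)) ^ nat (- A $$ (j, i)))"
  by (simp add: arithmetic_Y_frieze_patterns_def)

lemma frieze_shift_closed:
  assumes "k \<in> arithmetic_Y_frieze_patterns r A"
  shows "frieze_shift k \<in> arithmetic_Y_frieze_patterns r A"
  unfolding arithmetic_Y_frieze_patterns_def
proof (intro CollectI conjI allI impI)
  \<comment> \<open>The second index ranges over all integers, so points outside the index set stay
    outside under the shift and keep the value \<open>undefined\<close>.\<close>
  show "frieze_shift k \<in> ({..<r} \<times> UNIV) \<rightarrow>\<^sub>E {0<..}"
    using assms
    by (auto simp: arithmetic_Y_frieze_patterns_def frieze_shift_def PiE_iff extensional_def)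
qed (use frieze_rel[OF assms, of _ "_ + 1"] in \<open>simp add: frieze_shift_def\<close>)

text \<open>Besides \<open>k (i, m + 1)\<close>, the relation at \<open>i\<close> refers in column
  \<open>m + 1\<close> only to smaller indices, so the new column is computed from
  \<open>i = 0\<close> upwards, dividing by the positive \<open>k (i, m)\<close>.\<close>

lemma frieze_column_determines_next:
  assumes k: "k \<in> arithmetic_Y_frieze_patterns r A" and l: "l \<in> arithmetic_Y_frieze_patterns r A"
    and eq: "\<And>i. i < r \<Longrightarrow> k (i, m) = l (i, m)" and "i < r"
  shows "k (i, m + 1) = l (i, m + 1)"
  using \<open>i < r\<close>
proof (induction i rule: less_induct)
  case (less i)
  have "k (i, m) * k (i, m + 1) = l (i, m) * l (i, m + 1)"
    unfolding frieze_rel[OF k less.prems] frieze_rel[OF l less.prems]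
    by (intro arg_cong2[where f = "(*)"] prod.cong refl) (use eq less in auto)
  thus ?case using eq[OF less.prems] frieze_pos[OF k less.prems, of m] by simp
qed

text \<open>The mirror image: in column \<open>m\<close> only larger indices occur besides
  \<open>k (i, m)\<close>, so the induction runs from \<open>r - 1\<close> downwards, on the measure
  \<open>r - i\<close>.\<close>

lemma frieze_column_determines_previous:
  assumes k: "k \<in> arithmetic_Y_frieze_patterns r A" and l: "l \<in> arithmetic_Y_frieze_patterns r A"
    and eq: "\<And>i. i < r \<Longrightarrow> k (i, m + 1) = l (i, m + 1)" and "i < r"
  shows "k (i, m) = l (i, m)"
  using \<open>i < r\<close>
proof (induction "r - i" arbitrary: i rule: less_induct)
  case less
  have "k (i, m) * k (i, m + 1) = l (i, m) * l (i, m + 1)"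
    unfolding frieze_rel[OF k less.prems] frieze_rel[OF l less.prems]
    by (intro arg_cong2[where f = "(*)"] prod.cong refl) (use eq less in auto)
  thus ?case using eq[OF less.prems] frieze_pos[OF k less.prems, of "m + 1"] by simp
qed

lemma frieze_eqI:
  assumes k: "k \<in> arithmetic_Y_frieze_patterns r A" and l: "l \<in> arithmetic_Y_frieze_patterns r A"
    and eq: "\<And>i. i < r \<Longrightarrow> k (i, 0) = l (i, 0)"
  shows "k = l"
proof -
  have all: "\<forall>i<r. k (i, m) = l (i, m)" for m
  proof (induction m rule: int_induct[where k = 0])
    case base
    show ?case using eq by simp
  next
    case (step1 m)
    thus ?case using frieze_column_determines_next[OF k l] by blast
  next
    case (step2 m)
    thus ?case using frieze_column_determines_previous[OF k l, of "m - 1"] by simp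
  qed
  show ?thesis
  proof (rule PiE_ext)
    show "k \<in> ({..<r} \<times> UNIV) \<rightarrow>\<^sub>E {0<..}" "l \<in> ({..<r} \<times> UNIV) \<rightarrow>\<^sub>E {0<..}"
      using k l by (auto simp: arithmetic_Y_frieze_patterns_def)
  qed (use all in auto)
qed

text \<open>Restriction to column 0 is injective on patterns, and it maps these ones into a finite
  set of integer vectors.\<close>

lemma finite_friezes_with_bounded_column:
  "finite {k \<in> arithmetic_Y_frieze_patterns r A. \<forall>i<r. k (i, 0) \<le> N}" (is "finite ?V")
proof -
  have "inj_on (\<lambda>k. \<lambda>i\<in>{..<r}. k (i, 0)) ?V"
  proof (rule inj_onI)
    fix k l assume "k \<in> ?V" "l \<in> ?V" "(\<lambda>i\<in>{..<r}. k (i, 0)) = (\<lambda>i\<in>{..<r}. l (i, 0))"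
    moreover from this(3) have "k (i, 0) = l (i, 0)" if "i < r" for i
      using that by (metis lessThan_iff restrict_apply')
    ultimately show "k = l" by (intro frieze_eqI[of k r A l]) auto
  qed
  moreover have "(\<lambda>k. \<lambda>i\<in>{..<r}. k (i, 0)) ` ?V \<subseteq> {..<r} \<rightarrow>\<^sub>E {0..N}"
    using frieze_pos by (fastforce intro: less_imp_le)
  hence "finite ((\<lambda>k. \<lambda>i\<in>{..<r}. k (i, 0)) ` ?V)"
    by (rule finite_subset) (intro finite_PiE, auto)
  ultimately show ?thesis using finite_imageD by blast
qed

section \<open>From finite type to a positive definite form\<close>

lemma submatrix_lessThan:
  assumes "A \<in> carrier_mat r r" and "n \<le> r"
  shows "submatrix A {..<n} {..<n} = mat n n (\<lambda>(i, j). A $$ (i, j))"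
proof -
  have "{i. i < r \<and> i < n} = {..<n}" using assms(2) by auto
  moreover have pick: "pick {..<n} i = i" if "i < n" for i
  proof -
    have "{a \<in> {..<n}. a < i} = {..<i}" using that by auto
    thus ?thesis using pick_card_in_set[of i "{..<n}"] that by simp
  qed
  ultimately show ?thesis
    using assms by (intro eq_matI) (auto simp: submatrix_def)
qed

lemma det_scale_rows:
  fixes f :: "nat \<Rightarrow> nat \<Rightarrow> 'a :: comm_ring_1"
  shows "det (mat n n (\<lambda>(i, j). d i * f i j)) = (\<Prod>i<n. d i) * det (mat n n (\<lambda>(i, j). f i j))"
proof -
  have "mat n n (\<lambda>(i, j). d i * f i j) =
    mat n n (\<lambda>(i, j). if i = j then d i else 0) * mat n n (\<lambda>(i, j). f i j)"
    by (rule eq_matI) (auto simp: scalar_prod_def if_distrib if_distribR sum.delta cong: if_cong)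
  moreover have "det (mat n n (\<lambda>(i, j). if i = j then d i else 0)) = (\<Prod>i<n. d i)"
    by (subst det_upper_triangular[where n = n])
      (auto simp: upper_triangular_def diag_mat_def prod.list_conv_set_nth atLeast0LessThan intro!: prod.cong)
  ultimately show ?thesis by (simp add: det_mult[where n = n])
qed

text \<open>Scaling the rows multiplies the leading principal minors of \<open>A\<close> by products
  of the positive \<open>d i\<close>, so those of the symmetrised matrix are positive too and
  \<open>sylvester_criterion\<close> applies over the reals.\<close>

lemma finite_type_coercive:
  assumes A: "A \<in> carrier_mat r r" and fin: "finite_type r A" and d: "\<And>i. i < r \<Longrightarrow> 0 < d i"
    and sym: "\<And>i j. i < r \<Longrightarrow> j < r \<Longrightarrow> d i * A $$ (i, j) = d j * A $$ (j, i)"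
  shows "\<exists>\<mu>>0. \<forall>x. \<mu> * (\<Sum>i<r. (x i)\<^sup>2) \<le> qform r (\<lambda>i j. of_int (d i * A $$ (i, j))) x"
proof (rule sylvester_criterion)
  fix k assume k: "0 < k" "k \<le> r"
  have "0 < det (submatrix A {..<k} {..<k})"
    using k by (intro fin[unfolded finite_type_def, rule_format]) auto
  hence "0 < det (mat k k (\<lambda>(i, j). A $$ (i, j)))" by (simp add: submatrix_lessThan[OF A k(2)])
  moreover have "0 < (\<Prod>i<k. d i)" using d k by (intro prod_pos) auto
  ultimately have "0 < det (mat k k (\<lambda>(i, j). d i * A $$ (i, j)))" by (simp add: det_scale_rows)
  moreover have "mat k k (\<lambda>(i, j). real_of_int (d i * A $$ (i, j))) =
      map_mat of_int (mat k k (\<lambda>(i, j). d i * A $$ (i, j)))" by (rule eq_matI) auto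
  ultimately show "0 < det (mat k k (\<lambda>(i, j). real_of_int (d i * A $$ (i, j))))"
    by (simp only: of_int_hom.hom_det of_int_0_less_iff)
qed (use sym in simp)

lemma symmetrisable_matE:
  assumes "symmetrisable_mat r A" and A: "A \<in> carrier_mat r r"
  obtains d where "\<And>i. i < r \<Longrightarrow> 0 < d i"
    and "\<And>i j. i < r \<Longrightarrow> j < r \<Longrightarrow> d i * A $$ (i, j) = d j * A $$ (j, i)"
proof -
  obtain D where D: "D \<in> carrier_mat r r" "diagonal_mat D" "\<And>i. i < r \<Longrightarrow> 0 < D $$ (i, i)"
    "transpose_mat (D * A) = D * A"
    using assms unfolding symmetrisable_mat_def by blast
  have DA: "(D * A) $$ (i, j) = D $$ (i, i) * A $$ (i, j)" if "i < r" "j < r" for i j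
  proof -
    have "(D * A) $$ (i, j) = (\<Sum>l<r. D $$ (i, l) * A $$ (l, j))"
      using that D(1) A by (simp add: scalar_prod_def atLeast0LessThan)
    also have "\<dots> = (\<Sum>l<r. if l = i then D $$ (i, i) * A $$ (i, j) else 0)"
      using that D(1,2) by (intro sum.cong) (auto simp: diagonal_mat_def)
    finally show ?thesis using that by simp
  qed
  show thesis
  proof (rule that[of "\<lambda>i. D $$ (i, i)"])
    fix i j assume ij: "i < r" "j < r"
    have "(D * A) $$ (i, j) = transpose_mat (D * A) $$ (i, j)" using D(4) by simp
    also have "\<dots> = (D * A) $$ (j, i)" using ij D(1) A by simp
    finally show "D $$ (i, i) * A $$ (i, j) = D $$ (j, j) * A $$ (j, i)" using DA ij by simp
  qed (use D in auto)
qed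

section \<open>Logarithms of friezes\<close>

text \<open>The entries of a pattern are positive integers, hence at least 1; this keeps
  \<open>1 / x\<close>, and with it the gap between the two logarithms, at most 1.\<close>

lemma ln_one_plus_bounds:
  fixes x :: real
  assumes "1 \<le> x"
  shows "ln x \<le> ln (1 + x)" and "ln (1 + x) \<le> ln x + 1"
proof -
  show "ln x \<le> ln (1 + x)" using assms by simp
  have "1 + x = x * (1 + 1 / x)" using assms by (simp add: field_simps)
  moreover have "0 < 1 + 1 / x" using assms by (simp add: add_pos_pos)
  ultimately have "ln (1 + x) = ln x + ln (1 + 1 / x)" using assms by (simp add: ln_mult_pos)
  also have "\<dots> \<le> ln x + 1 / x" using assms by (simp add: ln_add_one_self_le_self)
  also have "\<dots> \<le> ln x + 1" using assms by simp
  finally show "ln (1 + x) \<le> ln x + 1" .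
qed

text \<open>Taking logarithms makes the relation linear except for \<open>ln (1 + k)\<close>;
  replacing that by \<open>ln k\<close> costs at most 1 per unit of exponent. The bound adds up all
  entries of \<open>A\<close> so that one constant serves every \<open>i\<close>, \<open>m\<close>
  and \<open>k\<close>.\<close>

lemma frieze_log_recurrence:
  assumes A: "cartan_matrix r A" and k: "k \<in> arithmetic_Y_frieze_patterns r A" and i: "i < r"
  shows "\<bar>ln (k (i, m)) + ln (k (i, m + 1)) + (\<Sum>j\<in>{i<..<r}. A $$ (j, i) * ln (k (j, m)))
      + (\<Sum>j<i. A $$ (j, i) * ln (k (j, m + 1)))\<bar> \<le> (\<Sum>i<r. \<Sum>j<r. real_of_int \<bar>A $$ (j, i)\<bar>)"
proof -
  have pos: "0 < real_of_int (k (j, m))" "1 \<le> real_of_int (k (j, m))" if "j < r" for j m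
    using frieze_pos[OF k that, of m] by auto
  have exponent: "real (nat (- A $$ (j, i))) = - real_of_int (A $$ (j, i))" if "j < r" "j \<noteq> i" for j
  proof -
    have "A $$ (j, i) \<le> 0" using A i that by (simp add: cartan_matrix_def)
    thus ?thesis by simp
  qed
  define \<epsilon> where "\<epsilon> j m = ln (1 + real_of_int (k (j, m))) - ln (k (j, m))" for j m
  have \<epsilon>: "\<bar>\<epsilon> j m\<bar> \<le> 1" if "j < r" for j m
    using ln_one_plus_bounds[OF pos(2)[OF that, of m]] by (simp add: \<epsilon>_def)
  \<comment> \<open>\<open>J\<close> avoids \<open>i\<close> because \<open>nat\<close> would
    truncate the diagonal exponent \<open>-2\<close> to 0.\<close>
  have lnprod: "ln (\<Prod>j\<in>J. (1 + real_of_int (k (j, m))) ^ nat (- A $$ (j, i))) =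
      (\<Sum>j\<in>J. - real_of_int (A $$ (j, i)) * ln (1 + real_of_int (k (j, m))))"
    if J: "finite J" "J \<subseteq> {..<r} - {i}" for J m
  proof -
    have p: "0 < 1 + real_of_int (k (j, m))" if "j \<in> J" for j using pos(1)[of j m] J(2) that by force
    have "ln (\<Prod>j\<in>J. (1 + real_of_int (k (j, m))) ^ nat (- A $$ (j, i))) =
        (\<Sum>j\<in>J. ln ((1 + real_of_int (k (j, m))) ^ nat (- A $$ (j, i))))"
    proof (rule ln_prod[OF J(1)])
      fix j assume "j \<in> J"
      show "(1 + real_of_int (k (j, m))) ^ nat (- A $$ (j, i)) \<noteq> 0"
        using p[OF \<open>j \<in> J\<close>] by (metis less_irrefl zero_less_power)
    qed
    also have "\<dots> = (\<Sum>j\<in>J. - real_of_int (A $$ (j, i)) * ln (1 + real_of_int (k (j, m))))"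
    proof (rule sum.cong[OF refl])
      fix j assume j: "j \<in> J"
      show "ln ((1 + real_of_int (k (j, m))) ^ nat (- A $$ (j, i))) =
          - real_of_int (A $$ (j, i)) * ln (1 + real_of_int (k (j, m)))"
        unfolding ln_realpow using J(2) j by (subst exponent) auto
    qed
    finally show ?thesis .
  qed
  have prodpos: "0 < (\<Prod>j\<in>J. (1 + real_of_int (k (j, m))) ^ nat (- A $$ (j, i)))"
    if J: "J \<subseteq> {..<r}" for J m
    using pos(1)[of _ m] J by (intro prod_pos zero_less_power ballI add_pos_pos) auto
  have "real_of_int (k (i, m)) * real_of_int (k (i, m + 1)) =
     (\<Prod>j\<in>{i<..<r}. (1 + real_of_int (k (j, m))) ^ nat (- A $$ (j, i))) *
     (\<Prod>j\<in>{..<i}. (1 + real_of_int (k (j, m + 1))) ^ nat (- A $$ (j, i)))"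
    using arg_cong[OF frieze_rel[OF k i, of m], of real_of_int] by simp
  hence "ln (real_of_int (k (i, m)) * real_of_int (k (i, m + 1))) = ln (
     (\<Prod>j\<in>{i<..<r}. (1 + real_of_int (k (j, m))) ^ nat (- A $$ (j, i))) *
     (\<Prod>j\<in>{..<i}. (1 + real_of_int (k (j, m + 1))) ^ nat (- A $$ (j, i))))"
    by (rule arg_cong)
  also have "\<dots> = (\<Sum>j\<in>{i<..<r}. - real_of_int (A $$ (j, i)) * ln (1 + real_of_int (k (j, m))))
      + (\<Sum>j<i. - real_of_int (A $$ (j, i)) * ln (1 + real_of_int (k (j, m + 1))))"
    using i by (subst ln_mult_pos[OF prodpos prodpos]) (auto simp: lnprod subset_iff)
  also have "ln (real_of_int (k (i, m)) * real_of_int (k (i, m + 1))) = ln (k (i, m)) + ln (k (i, m + 1))"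
    using pos(1)[OF i] by (simp add: ln_mult_pos)
  finally have "ln (k (i, m)) + ln (k (i, m + 1)) + (\<Sum>j\<in>{i<..<r}. A $$ (j, i) * ln (k (j, m)))
      + (\<Sum>j<i. A $$ (j, i) * ln (k (j, m + 1)))
    = - ((\<Sum>j\<in>{i<..<r}. A $$ (j, i) * \<epsilon> j m) + (\<Sum>j<i. A $$ (j, i) * \<epsilon> j (m + 1)))"
    by (simp add: \<epsilon>_def sum_subtractf sum_negf algebra_simps)
  moreover have "\<bar>(\<Sum>j\<in>{i<..<r}. A $$ (j, i) * \<epsilon> j m) + (\<Sum>j<i. A $$ (j, i) * \<epsilon> j (m + 1))\<bar>
      \<le> (\<Sum>i<r. \<Sum>j<r. real_of_int \<bar>A $$ (j, i)\<bar>)"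
  proof -
    have part: "\<bar>\<Sum>j\<in>J. A $$ (j, i) * \<epsilon> j m\<bar> \<le> (\<Sum>j\<in>J. real_of_int \<bar>A $$ (j, i)\<bar>)"
      if "J \<subseteq> {..<r}" for J m
    proof (rule order_trans[OF sum_abs], rule sum_mono)
      fix j assume "j \<in> J"
      hence "\<bar>\<epsilon> j m\<bar> \<le> 1" using \<epsilon> that by auto
      thus "\<bar>A $$ (j, i) * \<epsilon> j m\<bar> \<le> real_of_int \<bar>A $$ (j, i)\<bar>"
        by (simp add: abs_mult mult_left_le)
    qed
    have "\<bar>(\<Sum>j\<in>{i<..<r}. A $$ (j, i) * \<epsilon> j m) + (\<Sum>j<i. A $$ (j, i) * \<epsilon> j (m + 1))\<bar>
      \<le> (\<Sum>j\<in>{i<..<r}. real_of_int \<bar>A $$ (j, i)\<bar>) + (\<Sum>j<i. real_of_int \<bar>A $$ (j, i)\<bar>)"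
      using i by (intro order_trans[OF abs_triangle_ineq] add_mono part) auto
    also have "\<dots> = (\<Sum>j\<in>{i<..<r} \<union> {..<i}. real_of_int \<bar>A $$ (j, i)\<bar>)"
      by (subst sum.union_disjoint) auto
    also have "\<dots> \<le> (\<Sum>j<r. real_of_int \<bar>A $$ (j, i)\<bar>)" using i by (intro sum_mono2) auto
    also have "\<dots> \<le> (\<Sum>i<r. \<Sum>j<r. real_of_int \<bar>A $$ (j, i)\<bar>)"
      using i by (intro member_le_sum[of i _ "\<lambda>i. \<Sum>j<r. real_of_int \<bar>A $$ (j, i)\<bar>"] sum_nonneg) auto
    finally show ?thesis .
  qed
  ultimately show ?thesis by simp
qed

section \<open>Finiteness of the set of patterns\<close>

theorem theorem5p5:
  fixes r :: nat and A :: "int mat"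
  assumes "cartan_matrix r A"
    and "finite_type r A"
    and "indecomposable r A"
  shows "finite (arithmetic_Y_frieze_patterns r A)"
proof -
  have A: "A \<in> carrier_mat r r" and symm: "symmetrisable_mat r A"
    and diag: "\<And>i. i < r \<Longrightarrow> A $$ (i, i) = 2"
    using assms(1) by (auto simp: cartan_matrix_def)
  obtain d where d: "\<And>i. i < r \<Longrightarrow> 0 < d i"
    and sym: "\<And>i j. i < r \<Longrightarrow> j < r \<Longrightarrow> d i * A $$ (i, j) = d j * A $$ (j, i)"
    using symmetrisable_matE[OF symm A] by blast
  define b where "b i j = real_of_int (d i * A $$ (i, j))" for i j
  obtain \<mu> where \<mu>: "0 < \<mu>" "\<And>x. \<mu> * (\<Sum>i<r. (x i)\<^sup>2) \<le> qform r b x"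
    using finite_type_coercive[OF A assms(2) d sym] unfolding b_def by blast
  define C where "C = (\<Sum>i<r. \<Sum>j<r. real_of_int \<bar>A $$ (j, i)\<bar>)"
  have C: "0 \<le> C" unfolding C_def by (intro sum_nonneg) auto
  have bsym: "b i j = b j i" if "i < r" "j < r" for i j
    using that sym[of i j] by (simp add: b_def)
  obtain R where R: "\<And>y. (\<forall>i<r. \<forall>m. 0 \<le> y i m) \<Longrightarrow>
    (\<forall>i<r. \<forall>m. \<bar>b i i / 2 * (y i m + y i (Suc m)) + (\<Sum>j\<in>{i<..<r}. b i j * y j m)
       + (\<Sum>j<i. b i j * y j (Suc m))\<bar> \<le> C) \<Longrightarrow> \<exists>m. \<forall>i<r. y i m \<le> R"
    using recurrence_visits_bounded_set[OF bsym \<mu> C] by blast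
  \<comment> \<open>\<open>exp (d i * R)\<close> undoes \<open>y = ln k / d i\<close>. The sum
    stands in for a maximum, its terms being nonnegative.\<close>
  define N where "N = (\<Sum>i<r. \<lceil>exp (d i * R)\<rceil>)"
  show ?thesis
  proof (rule finite_if_orbits_visit_finite_set)
    show "inj frieze_shift" by (rule inj_frieze_shift)
    show "finite {k \<in> arithmetic_Y_frieze_patterns r A. \<forall>i<r. k (i, 0) \<le> N}"
      by (rule finite_friezes_with_bounded_column)
    fix k assume k: "k \<in> arithmetic_Y_frieze_patterns r A"
    show "frieze_shift k \<in> arithmetic_Y_frieze_patterns r A" by (rule frieze_shift_closed[OF k])
    \<comment> \<open>Dividing by \<open>d i\<close> turns the transposed entries
      \<open>A $$ (j, i)\<close> of the relation into the symmetric \<open>b\<close>, since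
      \<open>b i j = d j * A $$ (j, i)\<close>.\<close>
    define y where "y i m = ln (k (i, int m)) / d i" for i m
    have y0: "0 \<le> y i m" if "i < r" for i m
      using frieze_pos[OF k that, of "int m"] d[OF that] by (simp add: y_def)
    have bxy: "b i j * y j m = A $$ (j, i) * ln (k (j, int m))" if "i < r" "j < r" for i j m
      using d[OF that(2)] unfolding bsym[OF that] by (simp add: b_def y_def)
    have "\<bar>b i i / 2 * (y i m + y i (Suc m)) + (\<Sum>j\<in>{i<..<r}. b i j * y j m)
       + (\<Sum>j<i. b i j * y j (Suc m))\<bar> \<le> C" if i: "i < r" for i m
    proof -
      \<comment> \<open>The diagonal entry 2 gives \<open>b i i / 2 = d i\<close>, which cancels the
        denominator of \<open>y\<close>.\<close>
      have "b i i / 2 * (y i m + y i (Suc m)) = ln (k (i, int m)) + ln (k (i, int m + 1))"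
        using bxy[OF i i, of m] bxy[OF i i, of "Suc m"] diag[OF i] by (simp add: ring_distribs add.commute)
      moreover have "(\<Sum>j\<in>{i<..<r}. b i j * y j m) = (\<Sum>j\<in>{i<..<r}. A $$ (j, i) * ln (k (j, int m)))"
        using i by (intro sum.cong) (auto simp: bxy)
      moreover have "(\<Sum>j<i. b i j * y j (Suc m)) = (\<Sum>j<i. A $$ (j, i) * ln (k (j, int m + 1)))"
        using i by (intro sum.cong) (auto simp: bxy add.commute)
      ultimately show ?thesis
        using frieze_log_recurrence[OF assms(1) k i, of "int m"] by (simp only: C_def)
    qed
    then obtain m where m: "\<And>i. i < r \<Longrightarrow> y i m \<le> R" using R[of y] y0 by blast
    have "k (i, int m) \<le> N" if i: "i < r" for i
    proof -
      have kp: "0 < real_of_int (k (i, int m))" using frieze_pos[OF k i] by simp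
      have "ln (k (i, int m)) \<le> d i * R"
        using m[OF i] d[OF i] by (simp add: y_def field_simps)
      hence "exp (ln (k (i, int m))) \<le> exp (d i * R)" by simp
      hence "real_of_int (k (i, int m)) \<le> exp (d i * R)" using kp by simp
      hence "k (i, int m) \<le> \<lceil>exp (d i * R)\<rceil>" by linarith
      also have "\<dots> \<le> N" unfolding N_def
        using i by (intro member_le_sum[of i _ "\<lambda>i. \<lceil>exp (d i * R)\<rceil>"]) (auto intro: less_le_trans[OF _ exp_ge_zero])
      finally show ?thesis .
    qed
    moreover have "(frieze_shift ^^ m) k \<in> arithmetic_Y_frieze_patterns r A"
      by (induction m) (use k frieze_shift_closed in auto)
    \<comment> \<open>Shifting \<open>m\<close> times brings the bounded column \<open>m\<close> to
      position 0.\<close>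
    ultimately show "\<exists>m. (frieze_shift ^^ m) k \<in>
        {k \<in> arithmetic_Y_frieze_patterns r A. \<forall>i<r. k (i, 0) \<le> N}"
      by (intro exI[of _ m]) (simp add: frieze_shift_funpow)
  qed auto
qed

end
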